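(* Let $a_1,a_3\in\mathbb{Z}$ and let $E_{a_1,a_3}$ be the elliptic curve over $\mathbb{Q}$ given by $y^2+a_1xy+a_3y=x^3$. Let $p$ be an odd prime at which $E_{a_1,a_3}$ has good reduction, assume $p\nmid a_1$, and let $q=p^e$ satisfy $q\equiv 1\pmod 3$. Let $\rho\in\widehat{\mathbb{F}_q^*}$ be a character of order three and $\epsilon$ the trivial character. Then $$t_q(E_{a_1,a_3})=-q\cdot {}_2F_1\left(\left.\begin{array}{cc}\rho & \rho^2\\ & \epsilon\end{array}\right| 27a_1^{-3}a_3\right)_q,$$ where $27a_1^{-3}a_3$ is read in $\mathbb{F}_q$.
   Context: For a prime power $q$, every multiplicative character $\chi$ of $\mathbb{F}_q^*$ is extended to $\mathbb{F}_q$ by $\chi(0)=0$ (also for the trivial character $\epsilon$). For characters $A,B$ define the normalized Jacobi sum $\binom{A}{B}=\frac{B(-1)}{q}\sum_{x\in\mathbb{F}_q}A(x)\bar B(1-x)$. The Gaussian hypergeometric series is ${}_2F_1\left(\left.\begin{array}{cc}A_0 & A_1\\ & B_1\end{array}\right|x\right)_q=\frac{q}{q-1}\sum_{\chi\in\widehat{\mathbb{F}_q^*}}\binom{A_0\chi}{\chi}\binom{A_1\chi}{B_1\chi}\chi(x)$. If $\tilde E_{a_1,a_3}$ denotes the reduction of $E_{a_1,a_3}$ modulo $p$, then $t_q(E_{a_1,a_3})=q+1-\#\tilde E_{a_1,a_3}(\mathbb{F}_q)$, where $\#\tilde E_{a_1,a_3}(\mathbb{F}_q)$ counts projective $\mathbb{F}_q$-points.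 *)

theory Defs
  imports
    Complex_Main
    "HOL-Library.Cardinality"
    "HOL-Number_Theory.Number_Theory"
begin

text \<open>
  The term \<open>Weierstrass a\<^sub>1 a\<^sub>2 a\<^sub>3 a\<^sub>4 a\<^sub>6\<close> stands for the plane cubic
  \<open>y\<^sup>2 + a\<^sub>1 x y + a\<^sub>3 y = x\<^sup>3 + a\<^sub>2 x\<^sup>2 + a\<^sub>4 x + a\<^sub>6\<close>.
\<close>

datatype 'a weierstrass =
  Weierstrass (coef1: 'a) (coef2: 'a) (coef3: 'a) (coef4: 'a) (coef6: 'a)

fun disc :: "'a::comm_ring_1 weierstrass \<Rightarrow> 'a" where
  "disc (Weierstrass a1 a2 a3 a4 a6) =
    (let b2 = a1^2 + 4 * a2;
         b4 = 2 * a4 + a1 * a3;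
         b6 = a3^2 + 4 * a6;
         b8 = a1^2 * a6 + 4 * a2 * a6 - a1 * a3 * a4 + a2 * a3^2 - a4^2
     in - (b2^2 * b8) - 8 * b4^3 - 27 * b6^2 + 9 * b2 * b4 * b6)"

definition elliptic :: "'a::field weierstrass \<Rightarrow> bool" where
  "elliptic W \<longleftrightarrow> disc W \<noteq> 0"

text \<open>
  The second curve arises from the first by the admissible substitution
  \<open>x = u\<^sup>2 x' + r\<close>, \<open>y = u\<^sup>3 y' + u\<^sup>2 s x' + t\<close>.
\<close>

definition weierstrass_equiv :: "'a::field weierstrass \<Rightarrow> 'a weierstrass \<Rightarrow> bool" where
  "weierstrass_equiv W W' \<longleftrightarrow> (\<exists>u r s t. u \<noteq> 0 \<and>
     u * coef1 W' = coef1 W + 2 * s \<and>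
     u^2 * coef2 W' = coef2 W - s * coef1 W + 3 * r - s^2 \<and>
     u^3 * coef3 W' = coef3 W + r * coef1 W + 2 * t \<and>
     u^4 * coef4 W' = coef4 W - s * coef3 W + 2 * r * coef2 W
                      - (t + r * s) * coef1 W + 3 * r^2 - 2 * s * t \<and>
     u^6 * coef6 W' = coef6 W + r * coef4 W + r^2 * coef2 W + r^3
                      - t * coef3 W - t^2 - r * t * coef1 W)"

definition p_integral :: "nat \<Rightarrow> rat \<Rightarrow> bool" where
  "p_integral p x \<longleftrightarrow> \<not> int p dvd snd (quotient_of x)"

definition integral_model :: "nat \<Rightarrow> rat weierstrass \<Rightarrow> rat weierstrass \<Rightarrow> bool" where
  "integral_model p W W' \<longleftrightarrow> weierstrass_equiv W W' \<and> (\<forall>c\<in>set_weierstrass W'. p_integral p c)"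

text \<open>
  The discriminant of a \<open>p\<close>-integral equation is \<open>p\<close>-integral, so its \<open>p\<close>-adic
  valuation is the multiplicity of \<open>p\<close> in its numerator.
\<close>

definition disc_val :: "nat \<Rightarrow> rat weierstrass \<Rightarrow> nat" where
  "disc_val p W = multiplicity (int p) (fst (quotient_of (disc W)))"

definition minimal_model :: "nat \<Rightarrow> rat weierstrass \<Rightarrow> rat weierstrass \<Rightarrow> bool" where
  "minimal_model p W W' \<longleftrightarrow> integral_model p W W' \<and>
     (\<forall>W''. integral_model p W W'' \<longrightarrow> disc_val p W' \<le> disc_val p W'')"

text \<open>
  Good reduction at \<open>p\<close>: the discriminant of a \<open>p\<close>-minimal equation is nonzero modulo \<open>p\<close>.
\<close>

definition good_reduction :: "nat \<Rightarrow> rat weierstrass \<Rightarrow> bool" where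
  "good_reduction p W \<longleftrightarrow>
     (\<exists>W'. minimal_model p W W' \<and> \<not> int p dvd fst (quotient_of (disc W')))"

definition proj_rel :: "(('a::field \<times> 'a \<times> 'a) \<times> ('a \<times> 'a \<times> 'a)) set" where
  "proj_rel = {((X, Y, Z), (X', Y', Z')).
     \<exists>c. c \<noteq> 0 \<and> X' = c * X \<and> Y' = c * Y \<and> Z' = c * Z}"

definition cone :: "'a::field weierstrass \<Rightarrow> ('a \<times> 'a \<times> 'a) set" where
  "cone W = {(X, Y, Z). (X, Y, Z) \<noteq> (0, 0, 0) \<and>
     Y^2 * Z + coef1 W * X * Y * Z + coef3 W * Y * Z^2 =
       X^3 + coef2 W * X^2 * Z + coef4 W * X * Z^2 + coef6 W * Z^3}"

definition proj_points :: "'a::field weierstrass \<Rightarrow> ('a \<times> 'a \<times> 'a) set set" where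
  "proj_points W = cone W // proj_rel"

definition frob_trace :: "'a::{field,finite} weierstrass \<Rightarrow> int" where
  "frob_trace W = int CARD('a) + 1 - int (card (proj_points W))"

text \<open>
  The curve \<open>y\<^sup>2 + a\<^sub>1 x y + a\<^sub>3 y = x\<^sup>3\<close> with integer parameters, read in an arbitrary
  field: over \<open>rat\<close> it is the curve itself, over a field of characteristic \<open>p\<close> its
  reduction modulo \<open>p\<close>.
\<close>

definition E_curve :: "int \<Rightarrow> int \<Rightarrow> 'a::field weierstrass" where
  "E_curve a1 a3 = Weierstrass (of_int a1) 0 (of_int a3) 0 0"

text \<open>
  Characters of the multiplicative group, extended by \<open>0 \<mapsto> 0\<close>.
\<close>

definition mult_chars :: "('a::{field,finite} \<Rightarrow> complex) set" where
  "mult_chars = {\<chi>. \<chi> 0 = 0 \<and> \<chi> 1 = 1 \<and> (\<forall>x y. \<chi> (x * y) = \<chi> x * \<chi> y)}"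

definition triv_char :: "'a::{field,finite} \<Rightarrow> complex" where
  "triv_char x = (if x = 0 then 0 else 1)"

definition char_mult ::
    "('a::{field,finite} \<Rightarrow> complex) \<Rightarrow> ('a \<Rightarrow> complex) \<Rightarrow> 'a \<Rightarrow> complex" where
  "char_mult A B = (\<lambda>x. A x * B x)"

definition char_pow :: "('a::{field,finite} \<Rightarrow> complex) \<Rightarrow> nat \<Rightarrow> 'a \<Rightarrow> complex" where
  "char_pow A n = (char_mult A ^^ n) triv_char"

definition char_order :: "('a::{field,finite} \<Rightarrow> complex) \<Rightarrow> nat" where
  "char_order A = (LEAST n. 0 < n \<and> char_pow A n = triv_char)"

definition jacobi_binom ::
    "('a::{field,finite} \<Rightarrow> complex) \<Rightarrow> ('a \<Rightarrow> complex) \<Rightarrow> complex" where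
  "jacobi_binom A B =
     B (- 1) / of_nat CARD('a) * (\<Sum>x\<in>UNIV. A x * cnj (B (1 - x)))"

definition gauss_2F1 ::
    "('a::{field,finite} \<Rightarrow> complex) \<Rightarrow> ('a \<Rightarrow> complex) \<Rightarrow> ('a \<Rightarrow> complex) \<Rightarrow> 'a \<Rightarrow> complex" where
  "gauss_2F1 A0 A1 B1 x =
     of_nat CARD('a) / (of_nat CARD('a) - 1) *
     (\<Sum>\<chi>\<in>mult_chars.
        jacobi_binom (char_mult A0 \<chi>) \<chi> *
        jacobi_binom (char_mult A1 \<chi>) (char_mult B1 \<chi>) * \<chi> x)"

end

theory Submission
  imports Defs "HOL-Computational_Algebra.Polynomial"
begin

text \<open>
  For \<open>y \<noteq> 0\<close>, the points of the curve with ordinate \<open>y\<close> are the roots of the depressed cubic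
  \<open>x\<^sup>3 - a\<^sub>1 y x = y\<^sup>2 + a\<^sub>3 y\<close>. By Cardano, a cubic \<open>x\<^sup>3 - 3 c x = n\<close> with \<open>c \<noteq> 0\<close> has
  \<open>1 + \<Sum> \<rho>(w)\<close> roots, where \<open>w\<close> runs through the roots of the resolvent \<open>w\<^sup>2 - n w + c\<^sup>3\<close> and
  \<open>\<rho>\<close> is any character of order three. Hence minus the trace of Frobenius is a sum of \<open>\<rho>\<^sup>2(w)\<close>
  over the rational curve of all pairs \<open>(y, w)\<close>. Orthogonality of characters turns
  \<open>q \<cdot> \<^sub>2F\<^sub>1(\<rho>, \<rho>\<^sup>2; \<epsilon> | \<lambda>)\<close> into the sum of \<open>\<rho>(u) \<rho>\<^sup>2(v)\<close> over
  \<open>\<lambda> u v = (1 - u) (1 - v)\<close>, and a change of variables identifies both sums up to cubes.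
  Good reduction is needed to have \<open>\<lambda> \<noteq> 0, 1\<close>.
\<close>

subsection \<open>Multiplicative characters of a finite field\<close>

lemma card_field_gt_1: "1 < CARD('a::{field,finite})"
proof -
  have "card {0, 1 :: 'a} \<le> CARD('a)"
    by (intro card_mono) auto
  then show ?thesis
    by simp
qed

text \<open>The unit group of a finite field is known to be cyclic for fields given by a carrier, so
  the type is packaged as the record \<open>R\<close> and the result is translated back.\<close>

lemma finite_field_generator:
  obtains g :: "'a::{field,finite}" where "g \<noteq> 0" "\<And>x. x \<noteq> 0 \<Longrightarrow> \<exists>i. x = g ^ i"
proof -
  define R :: "'a ring" where
    "R = \<lparr>carrier = UNIV, monoid.mult = (*), one = 1, ring.zero = 0, add = (+)\<rparr>"
  have "\<exists>y. x + y = 0" for x :: 'a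
    using add.right_inverse by blast
  moreover have "\<exists>y. x * y = 1" if "x \<noteq> 0" for x :: 'a
    using that right_inverse by blast
  ultimately interpret R: field R
    unfolding R_def by unfold_locales (auto simp: algebra_simps Units_def)
  have pow: "x [^]\<^bsub>R\<^esub> i = x ^ i" for x and i :: nat
    by (induction i) (auto simp: R_def nat_pow_def)
  have carrier: "carrier (mult_of R) = UNIV - {0}"
    by (auto simp: R_def)
  obtain g where "g \<in> carrier (mult_of R)" "carrier (mult_of R) = {g [^]\<^bsub>R\<^esub> i |i::nat. i \<in> UNIV}"
    using R.finite_field_mult_group_has_gen by auto
  then have "g \<noteq> 0" "UNIV - {0} = {g ^ i |i. i \<in> UNIV}"
    unfolding carrier by (auto simp only: pow)
  then show ?thesis
    by (intro that) auto
qed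

text \<open>Multiplication by \<open>x\<close> permutes the nonzero elements; comparing their
  products and cancelling leaves the power of \<open>x\<close>.\<close>

lemma finite_field_power_card_minus_1:
  fixes x :: "'a::{field,finite}"
  assumes "x \<noteq> 0"
  shows "x ^ (CARD('a) - 1) = 1"
proof -
  have "(\<Prod>y\<in>UNIV - {0}. x * y) = (\<Prod>y\<in>UNIV - {0}. y)"
    by (rule prod.reindex_bij_witness[of _ "\<lambda>y. y / x" "\<lambda>y. x * y"]) (use assms in auto)
  moreover have "(\<Prod>y\<in>UNIV - {0}. x * y) = x ^ (CARD('a) - 1) * (\<Prod>y\<in>UNIV - {0}. y)"
    by (simp add: prod.distrib)
  ultimately show ?thesis
    by simp
qed

context
  fixes \<chi> :: "'a::{field,finite} \<Rightarrow> complex"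
  assumes \<chi>: "\<chi> \<in> mult_chars"
begin

lemma mult_char_0: "\<chi> 0 = 0" and mult_char_1: "\<chi> 1 = 1"
  and mult_char_mult: "\<chi> (x * y) = \<chi> x * \<chi> y"
  using \<chi> by (auto simp: mult_chars_def)

lemma mult_char_power: "\<chi> (x ^ n) = \<chi> x ^ n"
  by (induction n) (simp_all add: mult_char_1 mult_char_mult)

lemma mult_char_power_card_minus_1:
  assumes "x \<noteq> 0"
  shows "\<chi> x ^ (CARD('a) - 1) = 1"
  using finite_field_power_card_minus_1[OF assms] mult_char_power[of x "CARD('a) - 1"] mult_char_1
  by simp

lemma norm_mult_char:
  assumes "x \<noteq> 0"
  shows "cmod (\<chi> x) = 1"
proof -
  have "cmod (\<chi> x) ^ (CARD('a) - 1) = 1"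
    using mult_char_power_card_minus_1[OF assms] by (metis norm_power norm_one)
  then show ?thesis
    using card_field_gt_1[where 'a='a]
    using power_eq_1_iff[of "cmod (\<chi> x)" "CARD('a) - 1"] by simp
qed

lemma mult_char_nonzero_iff: "\<chi> x \<noteq> 0 \<longleftrightarrow> x \<noteq> 0"
  using norm_mult_char[of x] mult_char_0 by (cases "x = 0") auto

lemma cnj_mult_char: "cnj (\<chi> x) = inverse (\<chi> x)"
proof (cases "x = 0")
  case False
  then have "\<chi> x * cnj (\<chi> x) = 1"
    using norm_mult_char[OF False] complex_norm_square[of "\<chi> x"] by simp
  then show ?thesis
    by (metis inverse_unique)
qed (simp add: mult_char_0)

lemma mult_char_inverse: "\<chi> (inverse x) = inverse (\<chi> x)"
proof (cases "x = 0")
  case False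
  then have "\<chi> x * \<chi> (inverse x) = 1"
    by (metis mult_char_mult mult_char_1 right_inverse)
  then show ?thesis
    by (metis inverse_unique)
qed (simp add: mult_char_0)

lemma mult_char_divide: "\<chi> (x / y) = \<chi> x / \<chi> y"
  unfolding divide_inverse mult_char_mult mult_char_inverse ..

lemma mult_char_minus_1_square: "\<chi> (- 1) * \<chi> (- 1) = 1"
  using mult_char_mult[of "- 1" "- 1"] mult_char_1 by simp

text \<open>Replacing \<open>x\<close> by \<open>g * x\<close> multiplies the sum by
  \<open>\<chi> g\<close>, and some \<open>g\<close> has value different from 1.\<close>

lemma sum_mult_char:
  assumes "\<chi> \<noteq> triv_char"
  shows "(\<Sum>x\<in>UNIV. \<chi> x) = 0"
proof -
  obtain g where g: "g \<noteq> 0" "\<chi> g \<noteq> 1"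
    using assms mult_char_0 by (auto simp: triv_char_def fun_eq_iff split: if_splits)
  have "\<chi> g * (\<Sum>x\<in>UNIV. \<chi> x) = (\<Sum>x\<in>UNIV. \<chi> (g * x))"
    by (simp add: sum_distrib_left mult_char_mult)
  also have "\<dots> = (\<Sum>x\<in>UNIV. \<chi> x)"
    by (rule sum.reindex_bij_witness[of _ "\<lambda>y. y / g" "\<lambda>y. g * y"]) (use g in auto)
  finally show ?thesis
    using g by simp
qed

text \<open>The factor \<open>triv_char\<close> matters at 0 for \<open>n = 0\<close>, where
  \<open>\<chi> 0 ^ 0 = 1\<close>.\<close>

lemma char_pow_mult_char: "char_pow \<chi> n = (\<lambda>x. triv_char x * \<chi> x ^ n)"
  unfolding char_pow_def by (induction n) (auto simp: char_mult_def)

end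

section \<open>The character group and its orthogonality relations\<close>

lemma triv_char_in_mult_chars: "triv_char \<in> mult_chars"
  by (auto simp: mult_chars_def triv_char_def)

lemma char_mult_in_mult_chars:
  "\<chi> \<in> mult_chars \<Longrightarrow> \<psi> \<in> mult_chars \<Longrightarrow> char_mult \<chi> \<psi> \<in> mult_chars"
  by (simp add: mult_chars_def char_mult_def mult_ac)

lemma char_pow_in_mult_chars:
  assumes "\<chi> \<in> mult_chars"
  shows "char_pow \<chi> n \<in> mult_chars"
  unfolding char_pow_def
  by (induction n) (simp_all add: triv_char_in_mult_chars char_mult_in_mult_chars assms)

text \<open>Every value is 0 or a root of unity of exponent \<open>q - 1\<close>, so characters map
  into a fixed finite set. Without finiteness, sums over \<open>mult_chars\<close> would be the
  default 0.\<close>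

lemma finite_mult_chars: "finite (mult_chars :: ('a::{field,finite} \<Rightarrow> complex) set)"
proof -
  define T where "T = insert 0 {z :: complex. z ^ (CARD('a) - 1) = 1}"
  have "finite T"
    unfolding T_def using card_field_gt_1[where 'a='a] by (simp add: finite_roots_unity)
  moreover have "mult_chars \<subseteq> {\<chi> :: 'a \<Rightarrow> complex. range \<chi> \<subseteq> T}"
  proof -
    have "\<chi> x \<in> T" if "\<chi> \<in> mult_chars" for \<chi> :: "'a \<Rightarrow> complex" and x
      using mult_char_0[OF that] mult_char_power_card_minus_1[OF that, of x]
      by (cases "x = 0") (auto simp: T_def)
    then show ?thesis
      by blast
  qed
  moreover have "{\<chi> :: 'a \<Rightarrow> complex. range \<chi> \<subseteq> T} = (UNIV :: 'a set) \<rightarrow>\<^sub>E T"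
    by (auto simp: PiE_UNIV_domain)
  ultimately show ?thesis
    by (metis finite finite_PiE finite_subset)
qed

text \<open>One character serves all \<open>z\<close>: it sends a generator to a primitive root of
  unity of order \<open>q - 1\<close> and is therefore injective on units.\<close>

lemma mult_chars_separate:
  fixes z :: "'a::{field,finite}"
  assumes "z \<noteq> 0" "z \<noteq> 1"
  obtains \<chi> where "\<chi> \<in> mult_chars" "\<chi> z \<noteq> 1"
proof -
  obtain g :: 'a where g: "g \<noteq> 0" "\<And>x. x \<noteq> 0 \<Longrightarrow> \<exists>i. x = g ^ i"
    by (rule finite_field_generator) blast
  define N where "N = CARD('a) - 1"
  have "N > 0"
    using card_field_gt_1[where 'a='a] by (simp add: N_def)
  have gN: "g ^ N = 1"
    unfolding N_def by (rule finite_field_power_card_minus_1) fact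
  have red: "g ^ i = g ^ (i mod N)" for i
    by (metis gN div_mult_mod_eq mult.commute mult_1 power_add power_mult power_one)
  define f where "f i = g ^ i" for i :: nat
  \<comment> \<open>The powers below \<open>N\<close> cover all \<open>N\<close> units, so by
    counting they are distinct, and the exponent of a unit is unique modulo
    \<open>N\<close>.\<close>
  have "f ` {..<N} = UNIV - {0}"
  proof (intro equalityI subsetI)
    fix x :: 'a assume "x \<in> UNIV - {0}"
    then obtain i where "x = g ^ i"
      using g by auto
    then have "x = f (i mod N)"
      using red by (simp add: f_def)
    then show "x \<in> f ` {..<N}"
      using \<open>N > 0\<close> by auto
  qed (use g in \<open>auto simp: f_def\<close>)
  then have "card (f ` {..<N}) = card {..<N}"
    by (simp add: N_def)
  then have inj: "inj_on f {..<N}"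
    by (intro eq_card_imp_inj_on) auto
  have g_eq_iff: "g ^ i = g ^ j \<longleftrightarrow> i mod N = j mod N" for i j
  proof
    assume "g ^ i = g ^ j"
    then have "f (i mod N) = f (j mod N)"
      using red by (simp add: f_def)
    then show "i mod N = j mod N"
      using inj \<open>N > 0\<close> by (simp add: inj_on_eq_iff)
  qed (metis red)
  \<comment> \<open>An arbitrary discrete logarithm; the character built from it does not depend on
    the choice, since \<open>\<zeta> ^ N = 1\<close>.\<close>
  define L where "L x = (SOME i. x = g ^ i)" for x
  have L: "x = g ^ L x" if "x \<noteq> 0" for x
    unfolding L_def by (rule someI_ex) (use g that in auto)
  define \<zeta> where "\<zeta> = cis (2 * pi / N)"
  have \<zeta>_power: "\<zeta> ^ i = cis (2 * pi * i / N)" for i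
    by (simp add: \<zeta>_def DeMoivre mult_ac)
  have "\<zeta> ^ N = 1"
    using \<open>N > 0\<close> by (simp add: \<zeta>_power)
  then have \<zeta>_red: "\<zeta> ^ i = \<zeta> ^ (i mod N)" for i
    by (metis div_mult_mod_eq mult.commute mult_1 power_add power_mult power_one)
  define \<chi> where "\<chi> x = (if x = 0 then 0 else \<zeta> ^ L x)" for x :: 'a
  have \<chi>_g: "\<chi> (g ^ i) = \<zeta> ^ i" for i
    using L[of "g ^ i"] g \<zeta>_red g_eq_iff by (metis \<chi>_def power_not_zero)
  have "\<chi> \<in> mult_chars"
  proof -
    have "\<chi> (x * y) = \<chi> x * \<chi> y" for x y
    proof (cases "x = 0 \<or> y = 0")
      case False
      then obtain i j where "x = g ^ i" "y = g ^ j"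
        using g by metis
      then show ?thesis
        by (simp add: \<chi>_g flip: power_add)
    qed (auto simp: \<chi>_def)
    moreover have "\<chi> 1 = 1"
      using \<chi>_g[of 0] by simp
    ultimately show ?thesis
      by (auto simp: mult_chars_def \<chi>_def)
  qed
  moreover have "\<chi> z \<noteq> 1"
  proof
    assume "\<chi> z = 1"
    define k where "k = L z mod N"
    have z: "z = g ^ k"
      using L[OF \<open>z \<noteq> 0\<close>] red by (simp add: k_def)
    have "\<zeta> ^ k = \<zeta> ^ 0"
      using \<open>\<chi> z = 1\<close> by (simp add: z \<chi>_g)
    moreover have "k < N" "k \<noteq> 0"
      using \<open>N > 0\<close> z \<open>z \<noteq> 1\<close> by (auto simp: k_def intro!: Nat.gr0I)
    ultimately show False
      using inj_onD[OF bij_betw_imp_inj_on[OF bij_betw_roots_unity[OF \<open>N > 0\<close>]], of k 0]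
      by (simp add: \<zeta>_power)
  qed
  ultimately show ?thesis
    by (rule that)
qed

text \<open>Dual shift argument: multiplication by a character \<open>\<psi>\<close> with
  \<open>\<psi> z \<noteq> 1\<close> permutes \<open>mult_chars\<close> and scales the sum by
  \<open>\<psi> z\<close>.\<close>

lemma sum_mult_chars_neq_1:
  fixes z :: "'a::{field,finite}"
  assumes "z \<noteq> 1"
  shows "(\<Sum>\<chi>\<in>mult_chars. \<chi> z) = 0"
proof (cases "z = 0")
  case True
  then show ?thesis
    by (intro sum.neutral) (simp add: mult_chars_def)
next
  case False
  obtain \<psi> where \<psi>: "\<psi> \<in> mult_chars" "\<psi> z \<noteq> 1"
    using mult_chars_separate[OF False assms] .
  have "\<psi> z * (\<Sum>\<chi>\<in>mult_chars. \<chi> z) = (\<Sum>\<chi>\<in>mult_chars. char_mult \<psi> \<chi> z)"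
    by (simp add: sum_distrib_left char_mult_def)
  also have "\<dots> = (\<Sum>\<chi>\<in>mult_chars. \<chi> z)"
  proof (rule sum.reindex_bij_witness[of _ "\<lambda>\<chi> x. \<chi> x / \<psi> x" "char_mult \<psi>"])
    fix \<chi> :: "'a \<Rightarrow> complex" assume \<chi>: "\<chi> \<in> mult_chars"
    \<comment> \<open>At 0, division by \<open>\<psi>\<close> undoes the multiplication because
      \<open>0 / 0 = 0\<close>.\<close>
    have "\<psi> x = 0 \<longleftrightarrow> \<chi> x = 0" for x
      using mult_char_nonzero_iff[OF \<psi>(1)] mult_char_nonzero_iff[OF \<chi>] by blast
    then show "(\<lambda>x. char_mult \<psi> \<chi> x / \<psi> x) = \<chi>" "char_mult \<psi> (\<lambda>x. \<chi> x / \<psi> x) = \<chi>"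
      by (auto simp: char_mult_def fun_eq_iff)
    show "char_mult \<psi> \<chi> \<in> mult_chars"
      using \<psi>(1) \<chi> by (rule char_mult_in_mult_chars)
    show "(\<lambda>x. \<chi> x / \<psi> x) \<in> mult_chars"
      using \<psi>(1) \<chi> by (auto simp: mult_chars_def)
  qed simp
  finally show ?thesis
    using \<psi> by simp
qed

text \<open>Double counting of \<open>\<chi> z\<close> over all pairs: summing over characters first
  leaves only \<open>z = 1\<close>, summing over \<open>z\<close> first leaves only
  \<open>triv_char\<close>.\<close>

lemma card_mult_chars: "card (mult_chars :: ('a::{field,finite} \<Rightarrow> complex) set) = CARD('a) - 1"
proof -
  have "of_nat (card (mult_chars :: ('a \<Rightarrow> complex) set)) = (\<Sum>\<chi>\<in>mult_chars. \<chi> (1 :: 'a))"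
    by (simp add: mult_chars_def)
  also have "\<dots> = (\<Sum>z\<in>UNIV. if z = (1 :: 'a) then \<Sum>\<chi>\<in>mult_chars. \<chi> z else 0)"
    by simp
  also have "\<dots> = (\<Sum>z\<in>UNIV. \<Sum>\<chi>\<in>mult_chars. \<chi> (z :: 'a))"
    by (intro sum.cong refl) (metis sum_mult_chars_neq_1)
  also have "\<dots> = (\<Sum>\<chi>\<in>mult_chars. \<Sum>z\<in>UNIV. \<chi> (z :: 'a))"
    by (rule sum.swap)
  also have "\<dots> = (\<Sum>\<chi>\<in>mult_chars. if \<chi> = triv_char then \<Sum>z\<in>UNIV. \<chi> (z :: 'a) else 0)"
    by (intro sum.cong refl) (metis sum_mult_char)
  also have "\<dots> = (\<Sum>z\<in>UNIV. triv_char (z :: 'a))"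
    by (simp add: finite_mult_chars triv_char_in_mult_chars)
  also have "\<dots> = (\<Sum>z\<in>UNIV - {0 :: 'a}. 1)"
    by (intro sum.mono_neutral_cong_right) (auto simp: triv_char_def)
  also have "\<dots> = of_nat (CARD('a) - 1)"
    by simp
  finally show ?thesis
    by (simp only: of_nat_eq_iff)
qed

lemma sum_mult_chars:
  fixes z :: "'a::{field,finite}"
  shows "(\<Sum>\<chi>\<in>mult_chars. \<chi> z) = (if z = 1 then of_nat CARD('a) - 1 else 0)"
proof (cases "z = 1")
  case True
  then have "(\<Sum>\<chi>\<in>mult_chars. \<chi> z) = (\<Sum>\<chi>\<in>(mult_chars :: ('a \<Rightarrow> complex) set). 1)"
    by (intro sum.cong refl) (simp add: mult_chars_def)
  then show ?thesis
    using True card_field_gt_1[where 'a='a] by (simp add: card_mult_chars of_nat_diff)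
qed (simp add: sum_mult_chars_neq_1)

subsection \<open>Good reduction\<close>

text \<open>Allowing any denominator prime to \<open>p\<close>, not only the one in lowest terms,
  makes closure under sums and products immediate.\<close>

lemma p_integral_iff_fraction:
  assumes "prime p"
  shows "p_integral p x \<longleftrightarrow> (\<exists>a b. \<not> int p dvd b \<and> x = of_int a / of_int b)"
proof
  assume "p_integral p x"
  then show "\<exists>a b. \<not> int p dvd b \<and> x = of_int a / of_int b"
    using quotient_of_div[of x "fst (quotient_of x)" "snd (quotient_of x)"]
    by (auto simp: p_integral_def)
next
  assume "\<exists>a b. \<not> int p dvd b \<and> x = of_int a / of_int b"
  then obtain a b where ab: "\<not> int p dvd b" "x = of_int a / of_int b"
    by blast
  obtain n d where nd: "quotient_of x = (n, d)"
    by force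
  have "b \<noteq> 0" "d > 0" "coprime n d"
    using ab quotient_of_denom_pos[OF nd] quotient_of_coprime[OF nd] by auto
  have "(of_int (a * d) :: rat) = of_int (n * b)"
    using ab quotient_of_div[OF nd] \<open>b \<noteq> 0\<close> \<open>d > 0\<close> by (simp add: field_simps)
  then have "a * d = n * b"
    by (simp only: of_int_eq_iff)
  then have "d dvd b"
    using \<open>coprime n d\<close> by (metis coprime_commute coprime_dvd_mult_right_iff dvd_triv_right)
  then show "p_integral p x"
    using ab(1) unfolding p_integral_def nd by (auto dest: dvd_trans)
qed

lemma p_integral_of_int: "prime p \<Longrightarrow> p_integral p (of_int k)"
  by (auto simp: p_integral_def prime_nat_iff)

lemma p_integral_add:
  assumes "prime p" "p_integral p x" "p_integral p y"
  shows "p_integral p (x + y)"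
proof -
  obtain a b c d where *: "\<not> int p dvd b" "x = of_int a / of_int b" "\<not> int p dvd d" "y = of_int c / of_int d"
    using assms by (auto simp: p_integral_iff_fraction)
  then have "b \<noteq> 0" "d \<noteq> 0"
    by auto
  then have "x + y = of_int (a * d + c * b) / of_int (b * d)"
    using * by (simp add: field_simps)
  moreover have "\<not> int p dvd b * d"
    using * assms by (simp add: prime_dvd_mult_iff)
  ultimately show ?thesis
    using assms by (subst p_integral_iff_fraction) blast+
qed

lemma p_integral_mult:
  assumes "prime p" "p_integral p x" "p_integral p y"
  shows "p_integral p (x * y)"
proof -
  obtain a b c d where *: "\<not> int p dvd b" "x = of_int a / of_int b" "\<not> int p dvd d" "y = of_int c / of_int d"
    using assms by (auto simp: p_integral_iff_fraction)
  have "x * y = of_int (a * c) / of_int (b * d)"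
    using * by simp
  moreover have "\<not> int p dvd b * d"
    using * assms by (simp add: prime_dvd_mult_iff)
  ultimately show ?thesis
    using assms by (subst p_integral_iff_fraction) blast+
qed

lemma p_integral_power: "prime p \<Longrightarrow> p_integral p x \<Longrightarrow> p_integral p (x ^ n)"
  by (induction n) (auto simp: p_integral_mult p_integral_of_int[of p 1, simplified])

section \<open>The classical invariant c_4 = b_2^2 - 24 b_4 and the discriminant under change of
  model\<close>

definition c4_inv :: "'a::comm_ring_1 weierstrass \<Rightarrow> 'a" where
  "c4_inv W = (coef1 W ^ 2 + 4 * coef2 W) ^ 2 - 24 * (2 * coef4 W + coef1 W * coef3 W)"

lemma p_integral_c4_inv:
  assumes "prime p" "\<forall>c\<in>set_weierstrass W. p_integral p c"
  shows "p_integral p (c4_inv W)"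
proof -
  have *: "p_integral p (coef1 W)" "p_integral p (coef2 W)" "p_integral p (coef3 W)"
    "p_integral p (coef4 W)"
    using assms(2) by (cases W; simp)+
  have num: "p_integral p 2" "p_integral p 4" "p_integral p (- 24)"
    using p_integral_of_int[OF assms(1), of 2] p_integral_of_int[OF assms(1), of 4]
      p_integral_of_int[OF assms(1), of "- 24"] by simp_all
  have "c4_inv W = (coef1 W ^ 2 + 4 * coef2 W) ^ 2 + (- 24) * (2 * coef4 W + coef1 W * coef3 W)"
    by (simp add: c4_inv_def)
  then show ?thesis
    by (simp only:) (intro p_integral_add p_integral_mult p_integral_power assms(1) * num)
qed

lemma c4_inv_Weierstrass:
  "c4_inv (Weierstrass a1 a2 a3 a4 a6) = (a1^2 + 4 * a2)^2 - 24 * (2 * a4 + a1 * a3)"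
  by (simp add: c4_inv_def)

(* The plain name of the Groebner basis method is shadowed by the one of HOL-Algebra. *)
lemma c4_inv_scale:
  fixes u :: "'a::field"
  shows "c4_inv (Weierstrass (u * a1) (u^2 * a2) (u^3 * a3) (u^4 * a4) (u^6 * a6)) =
    u^4 * c4_inv (Weierstrass a1 a2 a3 a4 a6)"
  unfolding c4_inv_Weierstrass by Groebner_Basis.algebra

lemma disc_scale:
  fixes u :: "'a::field"
  shows "disc (Weierstrass (u * a1) (u^2 * a2) (u^3 * a3) (u^4 * a4) (u^6 * a6)) =
    u^12 * disc (Weierstrass a1 a2 a3 a4 a6)"
  unfolding disc.simps Let_def by Groebner_Basis.algebra

text \<open>The scaled coefficients of \<open>W'\<close> belong to a translate of \<open>W\<close>
  by \<open>r\<close>, \<open>s\<close>, \<open>t\<close>, which changes neither quantity; the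
  scaling by \<open>u\<close> contributes the weights 4 and 12.\<close>

lemma weierstrass_equiv_c4_disc:
  fixes W W' :: "'a::field weierstrass"
  assumes "weierstrass_equiv W W'"
  obtains u where "u \<noteq> 0" "c4_inv W = u^4 * c4_inv W'" "disc W = u^12 * disc W'"
proof -
  obtain u r s t where "u \<noteq> 0" and *:
     "u * coef1 W' = coef1 W + 2 * s"
     "u^2 * coef2 W' = coef2 W - s * coef1 W + 3 * r - s^2"
     "u^3 * coef3 W' = coef3 W + r * coef1 W + 2 * t"
     "u^4 * coef4 W' = coef4 W - s * coef3 W + 2 * r * coef2 W
                      - (t + r * s) * coef1 W + 3 * r^2 - 2 * s * t"
     "u^6 * coef6 W' = coef6 W + r * coef4 W + r^2 * coef2 W + r^3
                      - t * coef3 W - t^2 - r * t * coef1 W"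
    using assms unfolding weierstrass_equiv_def by blast
  obtain a1 a2 a3 a4 a6 where W: "W = Weierstrass a1 a2 a3 a4 a6"
    by (cases W)
  obtain b1 b2 b3 b4 b6 where W': "W' = Weierstrass b1 b2 b3 b4 b6"
    by (cases W')
  note * = *[unfolded W W' weierstrass.sel]
  have "c4_inv (Weierstrass (u * b1) (u^2 * b2) (u^3 * b3) (u^4 * b4) (u^6 * b6)) = c4_inv W"
    unfolding W * c4_inv_Weierstrass by Groebner_Basis.algebra
  moreover have "disc (Weierstrass (u * b1) (u^2 * b2) (u^3 * b3) (u^4 * b4) (u^6 * b6)) = disc W"
    unfolding W * disc.simps Let_def by Groebner_Basis.algebra
  ultimately show ?thesis
    using \<open>u \<noteq> 0\<close> that unfolding W' c4_inv_scale disc_scale by metis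
qed

text \<open>The given equation is compared, through c_4 and the discriminant, with a model whose
  discriminant is a unit at \<open>p\<close>. If \<open>p\<close> divided a factor of
  \<open>D\<close>, it would divide \<open>C\<close> as well, and then \<open>a1\<close>.\<close>

lemma good_reduction_E_curve:
  assumes "prime p" "good_reduction p (E_curve a1 a3)" "\<not> int p dvd a1"
  shows "\<not> int p dvd a3" "\<not> int p dvd a1^3 - 27 * a3"
proof -
  define C D where "C = a1 * (a1^3 - 24 * a3)" and "D = a3^3 * (a1^3 - 27 * a3)"
  have p: "prime (int p)"
    using assms by simp
  obtain W' where W': "integral_model p (E_curve a1 a3) W'" "\<not> int p dvd fst (quotient_of (disc W'))"
    using assms by (auto simp: good_reduction_def minimal_model_def)
  then have eq: "weierstrass_equiv (E_curve a1 a3) W'" and int: "\<forall>c\<in>set_weierstrass W'. p_integral p c"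
    by (auto simp: integral_model_def)
  obtain u where u: "u \<noteq> 0" "c4_inv (E_curve a1 a3) = u^4 * c4_inv W'"
      "disc (E_curve a1 a3) = u^12 * disc W'"
    using eq by (rule weierstrass_equiv_c4_disc)
  have "c4_inv (E_curve a1 a3) = (of_int C :: rat)"
    by (simp add: c4_inv_def E_curve_def C_def algebra_simps power_numeral_reduce)
  moreover have "disc (E_curve a1 a3) = (of_int D :: rat)"
    by (simp add: E_curve_def D_def Let_def algebra_simps power_numeral_reduce)
  ultimately have "of_int C = u^4 * c4_inv W'" "of_int D = u^12 * disc W'"
    using u by simp_all
  \<comment> \<open>Eliminating \<open>u\<close> avoids valuations: \<open>disc W'\<close> is a \<open>p\<close>-unit, so \<open>p\<close> divides \<open>C\<close> if it divides \<open>D\<close>.\<close>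
  then have CD: "of_int C ^ 3 * disc W' = c4_inv W' ^ 3 * of_int D"
    by Groebner_Basis.algebra
  obtain n d where nd: "quotient_of (disc W') = (n, d)"
    by force
  obtain a b where ab: "\<not> int p dvd b" "c4_inv W' = of_int a / of_int b"
    using p_integral_c4_inv[OF assms(1) int] p_integral_iff_fraction[OF assms(1)] by blast
  have "b \<noteq> 0" "d > 0" "\<not> int p dvd n"
    using ab quotient_of_denom_pos[OF nd] W'(2) nd by auto
  then have "(of_int (C^3 * n * b^3) :: rat) = of_int (a^3 * D * d)"
    using CD ab quotient_of_div[OF nd] by (simp add: field_simps)
  then have *: "C^3 * n * b^3 = a^3 * D * d"
    by (simp only: of_int_eq_iff)
  have dvdC: "int p dvd C" if "int p dvd D"
  proof -
    have "int p dvd C^3 * n * b^3"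
      unfolding * using that by simp
    then show ?thesis
      using p ab \<open>\<not> int p dvd n\<close> by (auto simp: prime_dvd_mult_iff prime_dvd_power_iff)
  qed
  have dvd_a1: "int p dvd a1" if "int p dvd a1 ^ 4"
    using that p by (metis prime_dvd_power)
  show "\<not> int p dvd a3"
  proof
    assume "int p dvd a3"
    moreover from this have "int p dvd C"
      by (intro dvdC) (simp add: D_def power3_eq_cube)
    moreover have "a1 ^ 4 = C + 24 * a1 * a3"
      unfolding C_def by Groebner_Basis.algebra
    ultimately have "int p dvd a1 ^ 4"
      by simp
    then show False
      using assms dvd_a1 by blast
  qed
  show "\<not> int p dvd a1^3 - 27 * a3"
  proof
    assume "int p dvd a1^3 - 27 * a3"
    moreover from this have "int p dvd C"
      by (intro dvdC) (simp add: D_def)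
    \<comment> \<open>The coefficients 9 and 8 make the \<open>a1 * a3\<close> terms cancel, as
      \<open>9 * 24 = 8 * 27\<close>.\<close>
    moreover have "a1 ^ 4 = 9 * C - 8 * a1 * (a1^3 - 27 * a3)"
      unfolding C_def by Groebner_Basis.algebra
    ultimately have "int p dvd a1 ^ 4"
      by simp
    then show False
      using assms dvd_a1 by blast
  qed
qed

subsection \<open>Cubic characters and the Cardano resolvent\<close>

context
  fixes \<rho> :: "'a::{field,finite} \<Rightarrow> complex"
  assumes \<rho>: "\<rho> \<in> mult_chars" and nontriv: "\<rho> \<noteq> triv_char"
    and cubic: "\<And>x. x \<noteq> 0 \<Longrightarrow> \<rho> x ^ 3 = 1"
begin

text \<open>A nontrivial character of exponent 3 forces a non-cube, so cubing is not surjective,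
  hence not injective, on the finite field. Distinct elements with equal cubes have as ratio a root
  of \<open>T^2 + T + 1\<close>, whose discriminant is -3.\<close>

lemma exists_sqrt_minus_3: "\<exists>\<theta>::'a. \<theta>^2 = - 3"
proof -
  obtain g where g: "g \<noteq> 0" "\<rho> g \<noteq> 1"
    using nontriv mult_char_0[OF \<rho>] by (auto simp: triv_char_def fun_eq_iff split: if_splits)
  have "g \<noteq> x ^ 3" for x
    using g cubic[of x] mult_char_power[OF \<rho>, of x 3] by auto
  then have "\<not> surj (\<lambda>x::'a. x ^ 3)"
    unfolding surj_def by blast
  then have "\<not> inj (\<lambda>x::'a. x ^ 3)"
    using finite_UNIV_inj_surj[of "\<lambda>x::'a. x ^ 3"] by auto
  then obtain x y :: 'a where xy: "x ^ 3 = y ^ 3" "x \<noteq> y"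
    by (auto simp: inj_def)
  then have "y \<noteq> 0"
    by auto
  have "(x - y) * (x^2 + x * y + y^2) = x^3 - y^3"
    by Groebner_Basis.algebra
  then have "x^2 + x * y + y^2 = 0"
    using xy by simp
  moreover have "(2 * x + y)^2 + 3 * y^2 = 4 * (x^2 + x * y + y^2)"
    by Groebner_Basis.algebra
  ultimately have "(2 * x + y)^2 = - 3 * y^2"
    by (simp add: eq_neg_iff_add_eq_0)
  then have "((2 * x + y) / y)^2 = - 3"
    using \<open>y \<noteq> 0\<close> by (simp add: power_divide)
  then show ?thesis
    by blast
qed

text \<open>
  A square root \<open>e\<close> of \<open>x\<^sup>2 - 4 c\<close> solves \<open>x = z + c / z\<close>, and then \<open>z\<^sup>3\<close> is a root of the resolvent.
\<close>

lemma resolvent_root_cube: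
  fixes c x e n :: 'a
  assumes "(2::'a) \<noteq> 0" "c \<noteq> 0" and x: "x^3 - 3 * c * x = n" and e: "e^2 = x^2 - 4 * c"
  obtains w where "w^2 - n * w + c^3 = 0" "\<rho> w = 1"
proof -
  define z where "z = (x + e) / 2"
  have "2 * z = x + e"
    using assms(1) by (simp add: z_def)
  then have e2: "e = 2 * z - x"
    by simp
  have "2 * (2 * (z^2 - x * z + c)) = 0"
    using e unfolding e2 by Groebner_Basis.algebra
  then have z: "z^2 - x * z + c = 0"
    using assms(1) by (metis mult_eq_0_iff)
  then have "z \<noteq> 0"
    using assms(2) by auto
  have xz: "x * z = z^2 + c"
    using z by (simp add: algebra_simps)
  have "n * z^3 = (x * z)^3 - 3 * c * (x * z) * z^2"
    unfolding x[symmetric] by Groebner_Basis.algebra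
  also have "\<dots> = (z^3)^2 + c^3"
    unfolding xz by Groebner_Basis.algebra
  finally have "(z^3)^2 - n * z^3 + c^3 = 0"
    by simp
  moreover have "\<rho> (z^3) = 1"
    using cubic[OF \<open>z \<noteq> 0\<close>] by (simp add: mult_char_power[OF \<rho>])
  ultimately show ?thesis
    by (rule that)
qed

text \<open>The cases follow the resolvent: no root gives \<open>s = 0\<close>, a double root
  \<open>s = 1\<close>, two distinct roots with character value 1 \<open>s = 2\<close>, and any
  other two roots \<open>s = - 1\<close>.\<close>

lemma card_cubic_roots_le:
  fixes c n :: 'a
  assumes two: "(2::'a) \<noteq> 0" and three: "(3::'a) \<noteq> 0" and c: "c \<noteq> 0"
  shows "\<exists>s::int. (\<Sum>w | w^2 - n * w + c^3 = 0. \<rho> w) = of_int s \<and>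
    int (card {x. x^3 - 3 * c * x = n}) \<le> 1 + s"
proof -
  obtain \<theta> :: 'a where \<theta>: "\<theta>^2 = - 3"
    using exists_sqrt_minus_3 by blast
  then have "\<theta> \<noteq> 0"
    using three by auto
  define W where "W = {w. w^2 - n * w + c^3 = 0}"
  define X where "X = {x. x^3 - 3 * c * x = n}"
  have root: "\<exists>w\<in>W. \<rho> w = 1" if "x \<in> X" "e^2 = x^2 - 4 * c" for x e
  proof -
    have "x^3 - 3 * c * x = n"
      using that by (simp add: X_def)
    from resolvent_root_cube[OF two c this that(2)] show ?thesis
      by (auto simp: W_def)
  qed
  have "\<exists>s::int. (\<Sum>w\<in>W. \<rho> w) = of_int s \<and> int (card X) \<le> 1 + s"
  proof (cases "W = {}")
    case True
    have "x = y" if "x \<in> X" "y \<in> X" for x y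
    proof (rule ccontr)
      assume "x \<noteq> y"
      \<comment> \<open>A second root \<open>y\<close> solves the cofactor quadratic, of
        discriminant \<open>- 3 * (x^2 - 4 * c)\<close>. As -3 is a square, so is
        \<open>x^2 - 4 * c\<close>, and the resolvent would have a root.\<close>
      have "(x - y) * (x^2 + x * y + y^2 - 3 * c) = (x^3 - 3 * c * x) - (y^3 - 3 * c * y)"
        by Groebner_Basis.algebra
      also have "\<dots> = 0"
        using that by (simp add: X_def)
      finally have "x^2 + x * y + y^2 = 3 * c"
        using \<open>x \<noteq> y\<close> by simp
      then have "(x + 2 * y)^2 = \<theta>^2 * (x^2 - 4 * c)"
        unfolding \<theta> by Groebner_Basis.algebra
      then have "((x + 2 * y) / \<theta>)^2 = x^2 - 4 * c"
        using \<open>\<theta> \<noteq> 0\<close> by (simp add: power_divide)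
      then show False
        using root that(1) True by blast
    qed
    then have "card X \<le> Suc 0"
      by (simp add: card_le_Suc0_iff_eq)
    then show ?thesis
      using True by (intro exI[of _ 0]) simp
  next
    case False
    then obtain w where w: "w^2 - n * w + c^3 = 0"
      by (auto simp: W_def)
    define w' where "w' = n - w"
    have prod: "w * w' = c^3"
      using w unfolding w'_def by Groebner_Basis.algebra
    have n: "n = w + w'"
      by (simp add: w'_def)
    have W: "W = {w, w'}"
    proof -
      have "y^2 - n * y + c^3 = (y - w) * (y - w')" for y
        unfolding n prod[symmetric] by Groebner_Basis.algebra
      then show ?thesis
        unfolding W_def by auto
    qed
    have "w \<noteq> 0"
      using prod c by auto
    show ?thesis
    proof (cases "w = w'")
      case True
      \<comment> \<open>\<open>w^2 = c^3\<close> makes \<open>c\<close> the square and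
        \<open>w\<close> the cube of this \<open>z\<close>, and the cubic equation becomes
        \<open>(x - 2 * z) * (x + z)^2 = 0\<close>.\<close>
      define z where "z = w / c"
      have "w^2 = c^3"
        using prod True by (simp add: power2_eq_square)
      then have "w^3 = c^3 * w"
        by (simp add: power2_eq_square power3_eq_cube)
      then have wz: "w = z^3" and cz: "c = z^2"
        using c \<open>w^2 = c^3\<close> by (simp_all add: z_def field_simps power2_eq_square power3_eq_cube)
      have "\<rho> w = 1"
        using cubic[of z] c cz by (auto simp: wz mult_char_power[OF \<rho>])
      moreover have "X \<subseteq> {2 * z, - z}"
      proof
        fix x assume "x \<in> X"
        then have "(x - 2 * z) * (x + z)^2 = 0"
          unfolding X_def mem_Collect_eq n True[symmetric] wz cz by Groebner_Basis.algebra
        then show "x \<in> {2 * z, - z}"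
          by (auto simp: eq_neg_iff_add_eq_0)
      qed
      then have "card X \<le> 2"
        using card_mono[of "{2 * z, - z}" X] card_insert_le_m1[of 2 "{- z}" "2 * z"] by simp
      ultimately show ?thesis
        using W True by (intro exI[of _ 1]) simp
    next
      case False
      have prod_\<rho>: "\<rho> w * \<rho> w' = 1"
        using cubic[OF c] prod by (metis mult_char_mult[OF \<rho>] mult_char_power[OF \<rho>])
      have sum: "(\<Sum>w\<in>W. \<rho> w) = \<rho> w + \<rho> w'"
        using W False by simp
      show ?thesis
      proof (cases "\<rho> w = 1")
        case True
        define p where "p = [:- n, - 3 * c, 0, 1:]"
        have "p \<noteq> 0" "degree p = 3"
          by (simp_all add: p_def)
        moreover have "{x. poly p x = 0} = X"
          by (auto simp: p_def X_def algebra_simps power3_eq_cube)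
        ultimately have "card X \<le> 3"
          using card_poly_roots_bound[of p] by simp
        then show ?thesis
          using prod_\<rho> True by (intro exI[of _ 2]) (simp add: sum)
      next
        case r: False
        have "X = {}"
        proof (rule ccontr)
          assume "X \<noteq> {}"
          then obtain x where x: "x \<in> X"
            by blast
          \<comment> \<open>Both sides are the discriminant \<open>n^2 - 4 * c^3\<close> of the
            resolvent. It exhibits \<open>x^2 - 4 * c\<close> as a square if
            \<open>x^2 \<noteq> c\<close>; otherwise that number is \<open>- 3 * c\<close>, a square
            by the choice of \<open>\<theta>\<close>.\<close>
          have D: "(x^2 - 4 * c) * (x^2 - c)^2 = (w - w')^2"
            using x prod unfolding X_def mem_Collect_eq n by Groebner_Basis.algebra
          have "\<exists>e. e^2 = x^2 - 4 * c"
          proof (cases "x^2 = c")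
            case True
            then have "(\<theta> * x)^2 = x^2 - 4 * c"
              using \<theta> by (simp add: power_mult_distrib)
            then show ?thesis ..
          next
            case False
            then have "((w - w') / (x^2 - c))^2 = x^2 - 4 * c"
              using D by (simp add: power_divide field_simps)
            then show ?thesis ..
          qed
          then have "\<rho> w = 1 \<or> \<rho> w' = 1"
            using root[OF x] W by auto
          then show False
            using prod_\<rho> r by auto
        qed
        \<comment> \<open>\<open>\<rho> w\<close> is a primitive cube root of unity and
          \<open>\<rho> w'\<close> its inverse, so they sum to -1.\<close>
        have "(\<rho> w - 1) * (1 + \<rho> w + (\<rho> w)^2) = 0"
          using cubic[OF \<open>w \<noteq> 0\<close>] by Groebner_Basis.algebra
        then have "1 + \<rho> w + (\<rho> w)^2 = 0"
          using r by simp
        then have "\<rho> w * (\<rho> w + \<rho> w' + 1) = 0"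
          using prod_\<rho> by (simp add: algebra_simps power2_eq_square)
        then have "\<rho> w + \<rho> w' = - 1"
          using prod_\<rho> by (auto simp: eq_neg_iff_add_eq_0)
        then show ?thesis
          using \<open>X = {}\<close> by (intro exI[of _ "- 1"]) (simp add: sum)
      qed
    qed
  qed
  then show ?thesis
    by (simp add: W_def X_def)
qed

text \<open>
  Both sides have the same sum over all \<open>n\<close>, so the inequalities are equalities. This spares a
  proof that the cubic has a root when its resolvent has none.
\<close>

lemma card_cubic_roots:
  fixes c n :: 'a
  assumes two: "(2::'a) \<noteq> 0" and three: "(3::'a) \<noteq> 0" and c: "c \<noteq> 0"
  shows "of_nat (card {x. x^3 - 3 * c * x = n}) = 1 + (\<Sum>w | w^2 - n * w + c^3 = 0. \<rho> w)"
proof -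
  define S where "S n = (\<Sum>w | w^2 - n * w + c^3 = 0. \<rho> w)" for n
  define R where "R n = card {x. x^3 - 3 * c * x = n}" for n
  obtain s :: "'a \<Rightarrow> int" where s: "S n = of_int (s n)" "int (R n) \<le> 1 + s n" for n
    unfolding S_def R_def using card_cubic_roots_le[OF two three c] by metis
  have "(\<Sum>n\<in>UNIV. R n) = CARD('a)"
  proof -
    have "(\<Sum>n\<in>UNIV. R n) = card (\<Union>n. {x. x^3 - 3 * c * x = n})"
      unfolding R_def by (intro card_UN_disjoint[symmetric]) auto
    also have "(\<Union>n. {x. x^3 - 3 * c * x = n}) = UNIV"
      by auto
    finally show ?thesis .
  qed
  moreover have "(\<Sum>n\<in>UNIV. S n) = 0"
  proof -
    have "(\<Sum>n\<in>UNIV. S n) = (\<Sum>n\<in>UNIV. \<Sum>w\<in>UNIV. if w^2 - n * w + c^3 = 0 then \<rho> w else 0)"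
      unfolding S_def by (simp add: sum.If_cases)
    also have "\<dots> = (\<Sum>w\<in>UNIV. \<Sum>n\<in>UNIV. if w^2 - n * w + c^3 = 0 then \<rho> w else 0)"
      by (rule sum.swap)
    \<comment> \<open>For fixed \<open>w \<noteq> 0\<close> the resolvent equation is linear in
      \<open>n\<close> with one solution; \<open>w = 0\<close> contributes 0.\<close>
    also have "\<dots> = (\<Sum>w\<in>UNIV. \<rho> w)"
    proof (rule sum.cong[OF refl])
      fix w
      show "(\<Sum>n\<in>UNIV. if w^2 - n * w + c^3 = 0 then \<rho> w else 0) = \<rho> w"
      proof (cases "w = 0")
        case False
        then have "w^2 - n * w + c^3 = 0 \<longleftrightarrow> n = (w^2 + c^3) / w" for n
          by (auto simp: field_simps)
        then show ?thesis
          by simp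
      qed (use c in \<open>simp add: mult_char_0[OF \<rho>]\<close>)
    qed
    also have "\<dots> = 0"
      using sum_mult_char[OF \<rho> nontriv] .
    finally show ?thesis .
  qed
  then have "(of_int (\<Sum>n\<in>UNIV. s n) :: complex) = 0"
    by (simp add: s(1))
  then have "(\<Sum>n\<in>UNIV. s n) = 0"
    by (simp only: of_int_eq_0_iff)
  \<comment> \<open>The total is \<open>q + 0 - q\<close>, and every summand is nonnegative.\<close>
  ultimately have "(\<Sum>n\<in>UNIV. 1 + s n - int (R n)) = 0"
    by (simp add: sum.distrib sum_subtractf flip: of_nat_sum)
  then have "1 + s n - int (R n) = 0"
    using s(2) by (subst (asm) sum_nonneg_eq_0_iff) (auto simp: algebra_simps)
  then have "(of_int (int (R n)) :: complex) = of_int (1 + s n)"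
    by (simp only: of_int_eq_iff)
  then show ?thesis
    using s(1)[of n] by (simp add: S_def R_def)
qed

end

subsection \<open>The hypergeometric sum and the point count\<close>

text \<open>Conjugation inverts \<open>\<chi> (1 - u)\<close>, so the Jacobi sums run over
  \<open>A u * \<chi> (u / (1 - u))\<close> and its analogue for \<open>B\<close>. Summing over
  \<open>\<chi>\<close> then selects \<open>t u v = 1\<close> with weight
  \<open>q - 1\<close>.\<close>

lemma gauss_2F1_triv:
  fixes A B :: "'a::{field,finite} \<Rightarrow> complex"
  assumes A: "A \<in> mult_chars" and B: "B \<in> mult_chars" and x: "x \<noteq> 0"
  shows "of_nat CARD('a) * gauss_2F1 A B triv_char x =
    (\<Sum>(u, v) | u \<noteq> 0 \<and> v \<noteq> 0 \<and> x * u * v = (1 - u) * (1 - v). A u * B v)"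
proof -
  define q where "q = (of_nat CARD('a) :: complex)"
  have q: "q \<noteq> 0" "q \<noteq> 1"
    using card_field_gt_1[where 'a='a] by (auto simp: q_def)
  define t where "t u v = x * (u / (1 - u)) * (v / (1 - v))" for u v
  have "jacobi_binom (char_mult A \<chi>) \<chi> * jacobi_binom (char_mult B \<chi>) (char_mult triv_char \<chi>) * \<chi> x
      = 1 / q^2 * (\<Sum>u\<in>UNIV. \<Sum>v\<in>UNIV. A u * B v * \<chi> (t u v))" if \<chi>: "\<chi> \<in> mult_chars" for \<chi>
  proof -
    have "char_mult triv_char \<chi> = \<chi>"
      using mult_char_0[OF \<chi>] by (auto simp: char_mult_def triv_char_def)
    moreover have "jacobi_binom (char_mult C \<chi>) \<chi> = \<chi> (- 1) / q * (\<Sum>u\<in>UNIV. C u * \<chi> (u / (1 - u)))" for C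
      by (simp add: jacobi_binom_def char_mult_def q_def cnj_mult_char[OF \<chi>] mult_char_divide[OF \<chi>]
          divide_complex_def mult.assoc)
    ultimately have "jacobi_binom (char_mult A \<chi>) \<chi> * jacobi_binom (char_mult B \<chi>) (char_mult triv_char \<chi>) * \<chi> x
      = (\<chi> (- 1) * \<chi> (- 1)) / q^2 *
        ((\<Sum>u\<in>UNIV. A u * \<chi> (u / (1 - u))) * (\<Sum>v\<in>UNIV. B v * \<chi> (v / (1 - v))) * \<chi> x)"
      by (simp add: power2_eq_square)
    also have "(\<Sum>u\<in>UNIV. A u * \<chi> (u / (1 - u))) * (\<Sum>v\<in>UNIV. B v * \<chi> (v / (1 - v))) * \<chi> x =
      (\<Sum>u\<in>UNIV. \<Sum>v\<in>UNIV. A u * B v * \<chi> (t u v))"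
      unfolding t_def mult_char_mult[OF \<chi>] sum_product unfolding sum_distrib_right
      by (intro sum.cong refl) (simp only: mult_ac)
    finally show ?thesis
      by (simp add: mult_char_minus_1_square[OF \<chi>])
  qed
  then have "gauss_2F1 A B triv_char x =
    q / (q - 1) * (\<Sum>\<chi>\<in>mult_chars. 1 / q^2 * (\<Sum>u\<in>UNIV. \<Sum>v\<in>UNIV. A u * B v * \<chi> (t u v)))"
    unfolding gauss_2F1_def q_def[symmetric] by (simp cong: sum.cong)
  also have "\<dots> = q / (q - 1) / q^2 * (\<Sum>\<chi>\<in>mult_chars. \<Sum>u\<in>UNIV. \<Sum>v\<in>UNIV. A u * B v * \<chi> (t u v))"
    unfolding sum_distrib_left[symmetric] by simp
  also have "(\<Sum>\<chi>\<in>mult_chars. \<Sum>u\<in>UNIV. \<Sum>v\<in>UNIV. A u * B v * \<chi> (t u v))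
      = (\<Sum>u\<in>UNIV. \<Sum>\<chi>\<in>mult_chars. \<Sum>v\<in>UNIV. A u * B v * \<chi> (t u v))"
    by (rule sum.swap)
  also have "\<dots> = (\<Sum>u\<in>UNIV. \<Sum>v\<in>UNIV. \<Sum>\<chi>\<in>mult_chars. A u * B v * \<chi> (t u v))"
    by (intro sum.cong[OF refl] sum.swap)
  also have "\<dots> = (\<Sum>u\<in>UNIV. \<Sum>v\<in>UNIV. A u * B v * (if t u v = 1 then q - 1 else 0))"
    by (simp only: q_def sum_mult_chars flip: sum_distrib_left)
  also have "\<dots> = (q - 1) * (\<Sum>u\<in>UNIV. \<Sum>v\<in>UNIV. if t u v = 1 then A u * B v else 0)"
    by (simp add: sum_distrib_left if_distrib mult_ac cong: if_cong)
  also have "(\<Sum>u\<in>UNIV. \<Sum>v\<in>UNIV. if t u v = 1 then A u * B v else 0) =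
      (\<Sum>(u, v)\<in>UNIV. if t u v = 1 then A u * B v else 0)"
    by (simp add: sum.cartesian_product)
  also have "\<dots> = (\<Sum>(u, v) | t u v = 1. A u * B v)"
    by (intro sum.mono_neutral_cong_right) (auto split: if_splits)
  also have "{(u, v). t u v = 1} = {(u, v). u \<noteq> 0 \<and> v \<noteq> 0 \<and> x * u * v = (1 - u) * (1 - v)}"
  proof -
    have "t u v = 1 \<longleftrightarrow> u \<noteq> 0 \<and> v \<noteq> 0 \<and> x * u * v = (1 - u) * (1 - v)" for u v
    proof (cases "u = 1 \<or> v = 1")
      \<comment> \<open>Division by zero gives \<open>t u v = 0\<close> here, and the polynomial
        equation fails for nonzero \<open>u\<close>, \<open>v\<close> because
        \<open>x \<noteq> 0\<close>.\<close>
      case True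
      then show ?thesis
        using x by (auto simp: t_def)
    next
      case False
      then have "t u v = 1 \<longleftrightarrow> x * u * v = (1 - u) * (1 - v)"
        by (simp add: t_def)
      then show ?thesis
        using False by auto
    qed
    then show ?thesis
      by auto
  qed
  finally show ?thesis
    using q by (simp add: q_def[symmetric] power2_eq_square)
qed

section \<open>Projective points and affine solutions\<close>

definition affine_points :: "'a::field weierstrass \<Rightarrow> ('a \<times> 'a) set" where
  "affine_points W = {(x, y). y^2 + coef1 W * x * y + coef3 W * y =
     x^3 + coef2 W * x^2 + coef4 W * x + coef6 W}"

lemma proj_rel_Image_eq_iff:
  "proj_rel `` {P} = proj_rel `` {Q} \<longleftrightarrow> (P, Q) \<in> proj_rel"
proof -
  have "equiv UNIV (proj_rel :: (('a \<times> 'a \<times> 'a) \<times> _) set)"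
  proof (rule equivI)
    show "refl (proj_rel :: (('a \<times> 'a \<times> 'a) \<times> _) set)"
      by (auto simp: refl_on_def proj_rel_def intro!: exI[of _ 1])
    show "sym (proj_rel :: (('a \<times> 'a \<times> 'a) \<times> _) set)"
    proof (rule symI)
      fix P Q :: "'a \<times> 'a \<times> 'a" assume "(P, Q) \<in> proj_rel"
      then obtain c where "c \<noteq> 0" "Q = (c * fst P, c * fst (snd P), c * snd (snd P))"
        by (auto simp: proj_rel_def)
      then show "(Q, P) \<in> proj_rel"
        by (cases P) (auto simp: proj_rel_def intro!: exI[of _ "inverse c"])
    qed
    show "trans (proj_rel :: (('a \<times> 'a \<times> 'a) \<times> _) set)"
    proof (rule transI)
      fix P Q R :: "'a \<times> 'a \<times> 'a" assume "(P, Q) \<in> proj_rel" "(Q, R) \<in> proj_rel"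
      then obtain c d where "c \<noteq> 0" "Q = (c * fst P, c * fst (snd P), c * snd (snd P))"
         "d \<noteq> 0" "R = (d * fst Q, d * fst (snd Q), d * snd (snd Q))"
        by (auto simp: proj_rel_def)
      then show "(P, R) \<in> proj_rel"
        by (cases P) (auto simp: proj_rel_def intro!: exI[of _ "d * c"])
    qed
  qed auto
  then show ?thesis
    by (simp add: eq_equiv_class_iff)
qed

text \<open>At \<open>Z = 0\<close> the equation reduces to \<open>X^3 = 0\<close>, so
  \<open>(0 : 1 : 0)\<close> is the only point at infinity; elsewhere \<open>Z\<close> is scaled to
  1.\<close>

lemma proj_points_eq:
  fixes W :: "'a::field weierstrass"
  shows "proj_points W = insert (proj_rel `` {(0, 1, 0)})
    ((\<lambda>(x, y). proj_rel `` {(x, y, 1)}) ` affine_points W)"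
proof (intro equalityI subsetI)
  fix C assume "C \<in> proj_points W"
  then obtain X Y Z where C: "C = proj_rel `` {(X, Y, Z)}" and XYZ: "(X, Y, Z) \<in> cone W"
    by (auto simp: proj_points_def quotient_def)
  show "C \<in> insert (proj_rel `` {(0, 1, 0)})
      ((\<lambda>(x, y). proj_rel `` {(x, y, 1)}) ` affine_points W)"
  proof (cases "Z = 0")
    case True
    then have "X = 0" "Y \<noteq> 0"
      using XYZ by (auto simp: cone_def)
    then have "((0, 1, 0), (X, Y, Z)) \<in> proj_rel"
      using True by (auto simp: proj_rel_def)
    then show ?thesis
      unfolding C by (metis insertI1 proj_rel_Image_eq_iff)
  next
    case False
    have eq: "Y^2 * Z + coef1 W * X * Y * Z + coef3 W * Y * Z^2 =
       X^3 + coef2 W * X^2 * Z + coef4 W * X * Z^2 + coef6 W * Z^3"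
      using XYZ by (simp add: cone_def)
    have "(X / Z, Y / Z) \<in> affine_points W"
    proof -
      obtain x y where xy: "X = x * Z" "Y = y * Z"
        using False by (metis nonzero_divide_eq_eq)
      have "Z^3 * (y^2 + coef1 W * x * y + coef3 W * y) =
        Z^3 * (x^3 + coef2 W * x^2 + coef4 W * x + coef6 W)"
        using eq unfolding xy by Groebner_Basis.algebra
      then show ?thesis
        using False by (simp add: affine_points_def xy)
    qed
    moreover have "((X / Z, Y / Z, 1), (X, Y, Z)) \<in> proj_rel"
      using False by (auto simp: proj_rel_def)
    then have "C = proj_rel `` {(X / Z, Y / Z, 1)}"
      unfolding C by (metis proj_rel_Image_eq_iff)
    ultimately show ?thesis
      by (intro insertI2 image_eqI[of _ _ "(X / Z, Y / Z)"]) auto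
  qed
next
  fix C assume "C \<in> insert (proj_rel `` {(0, 1, 0)})
    ((\<lambda>(x, y). proj_rel `` {(x, y, 1)}) ` affine_points W)"
  then show "C \<in> proj_points W"
    unfolding proj_points_def
    by (auto intro!: quotientI simp: cone_def affine_points_def)
qed

text \<open>The point at infinity absorbs the \<open>+ 1\<close> in the trace.\<close>

lemma frob_trace_affine_points:
  fixes W :: "'a::{field,finite} weierstrass"
  shows "frob_trace W = int CARD('a) - int (card (affine_points W))"
proof -
  let ?f = "\<lambda>(x :: 'a, y). proj_rel `` {(x, y, 1)}"
  have "inj_on ?f (affine_points W)"
    unfolding inj_on_def by (clarsimp simp: proj_rel_Image_eq_iff) (auto simp: proj_rel_def)
  then have "card (?f ` affine_points W) = card (affine_points W)"
    by (rule card_image)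
  moreover have "proj_rel `` {(0, 1, 0)} \<notin> ?f ` affine_points W"
    by (clarsimp simp: proj_rel_Image_eq_iff) (auto simp: proj_rel_def)
  ultimately have "card (proj_points W) = Suc (card (affine_points W))"
    unfolding proj_points_eq by simp
  then show ?thesis
    by (simp add: frob_trace_def)
qed

text \<open>
  With \<open>c = a\<^sub>1 y / 3\<close>, a root of the resolvent quadratic is written as \<open>w = y m\<close>.
\<close>

lemma card_affine_points_cubic_char:
  fixes \<rho> :: "'a::{field,finite} \<Rightarrow> complex" and a1 a3 :: 'a
  assumes \<rho>: "\<rho> \<in> mult_chars" "\<rho> \<noteq> triv_char" "\<And>x. x \<noteq> 0 \<Longrightarrow> \<rho> x ^ 3 = 1"
    and two: "(2::'a) \<noteq> 0" and three: "(3::'a) \<noteq> 0" and a1: "a1 \<noteq> 0"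
  shows "of_nat (card (affine_points (Weierstrass a1 0 a3 0 0))) = of_nat CARD('a) +
    (\<Sum>(y, m) | y \<noteq> 0 \<and> m \<noteq> 0 \<and> m^2 - (y + a3) * m + (a1 / 3)^3 * y = 0. \<rho> (y * m))"
proof -
  define F where "F y = {x. x^3 - 3 * (a1 * y / 3) * x = y^2 + a3 * y}" for y
  define M where "M y = {m. m \<noteq> 0 \<and> m^2 - (y + a3) * m + (a1 / 3)^3 * y = 0}" for y
  have "affine_points (Weierstrass a1 0 a3 0 0) = (\<lambda>(y, x). (x, y)) ` (SIGMA y:UNIV. F y)"
    using three by (auto simp: affine_points_def F_def image_def algebra_simps)
  moreover have "inj_on (\<lambda>(y, x). (x, y)) (SIGMA y:UNIV. F y)"
    by (auto simp: inj_on_def)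
  ultimately have "card (affine_points (Weierstrass a1 0 a3 0 0)) = (\<Sum>y\<in>UNIV. card (F y))"
    by (simp add: card_image)
  also have "\<dots> = card (F 0) + (\<Sum>y\<in>UNIV - {0}. card (F y))"
    by (simp add: sum.remove)
  \<comment> \<open>At \<open>y = 0\<close> the cubic degenerates to \<open>x^3 = 0\<close>; its
    single root completes the main term \<open>q - 1\<close> from the other ordinates to
    \<open>q\<close>.\<close>
  also have "F 0 = {0}"
    by (auto simp: F_def)
  finally have "of_nat (card (affine_points (Weierstrass a1 0 a3 0 0))) =
      1 + (\<Sum>y\<in>UNIV - {0}. (of_nat (card (F y)) :: complex))"
    by simp
  also have "(\<Sum>y\<in>UNIV - {0}. of_nat (card (F y))) = (\<Sum>y\<in>UNIV - {0}. 1 + (\<Sum>m\<in>M y. \<rho> (y * m)))"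
  proof (rule sum.cong[OF refl])
    fix y :: 'a assume "y \<in> UNIV - {0}"
    then have y: "y \<noteq> 0"
      by simp
    have c: "a1 * y / 3 \<noteq> 0"
      using a1 y three by simp
    have "(y * m)^2 - (y^2 + a3 * y) * (y * m) + (a1 * y / 3)^3 =
        y^2 * (m^2 - (y + a3) * m + (a1 / 3)^3 * y)" for m
      by (simp add: power_mult_distrib power_divide algebra_simps power2_eq_square power3_eq_cube)
    then have M_iff: "m \<in> M y \<longleftrightarrow> (y * m)^2 - (y^2 + a3 * y) * (y * m) + (a1 * y / 3)^3 = 0" for m
      using y c a1 three by (auto simp: M_def)
    have "(\<Sum>w | w^2 - (y^2 + a3 * y) * w + (a1 * y / 3)^3 = 0. \<rho> w) = (\<Sum>m\<in>M y. \<rho> (y * m))"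
      by (rule sum.reindex_bij_witness[of _ "\<lambda>m. y * m" "\<lambda>w. w / y"]) (use y M_iff in auto)
    then show "of_nat (card (F y)) = 1 + (\<Sum>m\<in>M y. \<rho> (y * m))"
      using card_cubic_roots[OF \<rho> two three c, of "y^2 + a3 * y"] by (simp add: F_def)
  qed
  also have "\<dots> = of_nat (CARD('a) - 1) + (\<Sum>y\<in>UNIV - {0}. \<Sum>m\<in>M y. \<rho> (y * m))"
    by (simp add: sum.distrib)
  also have "(\<Sum>y\<in>UNIV - {0}. \<Sum>m\<in>M y. \<rho> (y * m)) = (\<Sum>(y, m)\<in>(SIGMA y:UNIV - {0}. M y). \<rho> (y * m))"
    by (rule sum.Sigma) auto
  also have "(SIGMA y:UNIV - {0}. M y) =
      {(y, m). y \<noteq> 0 \<and> m \<noteq> 0 \<and> m^2 - (y + a3) * m + (a1 / 3)^3 * y = 0}"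
    by (auto simp: M_def)
  finally show ?thesis
    using card_field_gt_1[where 'a='a] by (simp add: of_nat_diff)
qed

text \<open>The first relation reads \<open>y * (m - \<kappa>) = m * (m - l * \<kappa>)\<close>, so
  \<open>m\<close> parametrizes both curves, with \<open>v = \<kappa> / (\<kappa> - m)\<close> and
  \<open>u = m / (m - l * \<kappa>)\<close>. Then \<open>u * v^2 * (y * m)\<close> is a cube, and
  \<open>\<rho> u * \<rho> v ^ 2\<close> is the inverse of \<open>\<rho> (y * m)\<close>, that is,
  its square.\<close>

lemma sum_resolvent_reparametrize:
  fixes \<rho> :: "'a::{field,finite} \<Rightarrow> complex" and a \<kappa> l :: 'a
  assumes \<rho>: "\<rho> \<in> mult_chars" "\<And>x. x \<noteq> 0 \<Longrightarrow> \<rho> x ^ 3 = 1"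
    and a: "a \<noteq> 0" and l: "l \<noteq> 0" "l \<noteq> 1" and \<kappa>: "\<kappa> = a^3"
  shows "(\<Sum>(y, m) | y \<noteq> 0 \<and> m \<noteq> 0 \<and> m^2 - (y + l * \<kappa>) * m + \<kappa> * y = 0. (\<rho> (y * m))^2) =
    (\<Sum>(u, v) | u \<noteq> 0 \<and> v \<noteq> 0 \<and> l * u * v = (1 - u) * (1 - v). \<rho> u * \<rho> v ^ 2)"
proof -
  have \<kappa>0: "\<kappa> \<noteq> 0"
    using a \<kappa> by simp
  \<comment> \<open>\<open>g\<close> expresses \<open>u\<close> through \<open>y\<close> instead of
    \<open>l\<close>, and \<open>f\<close> solves \<open>g\<close> for \<open>y\<close> and
    \<open>m\<close>.\<close>
  define f where "f = (\<lambda>(u, v). (- \<kappa> * (v - 1)^2 / (u * v), \<kappa> * (v - 1) / v))"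
  define g where "g = (\<lambda>(y, m). (m^2 / ((m - \<kappa>) * y), \<kappa> / (\<kappa> - m)))"
  define A where "A = {(u, v). u \<noteq> 0 \<and> v \<noteq> 0 \<and> l * u * v = (1 - u) * (1 - v)}"
  define B where "B = {(y, m). y \<noteq> 0 \<and> m \<noteq> 0 \<and> m^2 - (y + l * \<kappa>) * m + \<kappa> * y = 0}"
  have fA: "f (u, v) \<in> B" and gf: "g (f (u, v)) = (u, v)" and
    val: "\<rho> u * \<rho> v ^ 2 = (case f (u, v) of (y, m) \<Rightarrow> (\<rho> (y * m))^2)" if uv: "(u, v) \<in> A" for u v
  proof -
    have u: "u \<noteq> 0" and v: "v \<noteq> 0" and eq: "l * u * v = (1 - u) * (1 - v)"
      using uv by (auto simp: A_def)
    have "v \<noteq> 1"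
      using eq u v l by auto
    define y m where "y = - \<kappa> * (v - 1)^2 / (u * v)" and "m = \<kappa> * (v - 1) / v"
    have f: "f (u, v) = (y, m)"
      by (simp add: f_def y_def m_def)
    have nz: "y \<noteq> 0" "m \<noteq> 0"
      using u v \<open>v \<noteq> 1\<close> \<kappa>0 by (auto simp: y_def m_def)
    have mv: "m * v = \<kappa> * (v - 1)" and yuv: "y * u * v = - \<kappa> * (v - 1)^2"
      using u v by (simp_all add: y_def m_def)
    have "u * v^2 * (m^2 - (y + l * \<kappa>) * m + \<kappa> * y) =
      u * (m * v)^2 - (y * u * v) * (m * v) - \<kappa> * (l * u * v) * (m * v) + \<kappa> * v * (y * u * v)"
      by Groebner_Basis.algebra
    also have "\<dots> = 0"
      unfolding mv yuv eq by Groebner_Basis.algebra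
    finally have "m^2 - (y + l * \<kappa>) * m + \<kappa> * y = 0"
      using u v by simp
    then show "f (u, v) \<in> B"
      using nz by (simp add: f B_def)
    have \<kappa>m: "(\<kappa> - m) * v = \<kappa>"
      using mv by (simp add: algebra_simps)
    then have "\<kappa> - m \<noteq> 0"
      using \<kappa>0 by auto
    then have v': "\<kappa> / (\<kappa> - m) = v"
      using \<kappa>m by (simp add: field_simps)
    have "v^2 * (u * ((m - \<kappa>) * y)) = - ((\<kappa> - m) * v) * (y * u * v)"
      by Groebner_Basis.algebra
    also have "\<dots> = (m * v)^2"
      unfolding \<kappa>m mv yuv by Groebner_Basis.algebra
    finally have "v^2 * (u * ((m - \<kappa>) * y)) = v^2 * m^2"
      by (simp add: power_mult_distrib mult.commute)
    then have "u * ((m - \<kappa>) * y) = m^2"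
      using v by simp
    moreover have "(m - \<kappa>) * y \<noteq> 0"
      using nz \<open>\<kappa> - m \<noteq> 0\<close> by simp
    ultimately have "m^2 / ((m - \<kappa>) * y) = u"
      by (simp add: divide_eq_eq)
    then show "g (f (u, v)) = (u, v)"
      using v' by (simp add: f g_def)
    have "u * v^2 * (y * m) = (y * u * v) * (m * v)"
      by Groebner_Basis.algebra
    also have "\<dots> = (- (a^2 * (v - 1)))^3"
      unfolding mv yuv \<kappa> by Groebner_Basis.algebra
    finally have "\<rho> (u * v^2 * (y * m)) = \<rho> (- (a^2 * (v - 1))) ^ 3"
      by (simp only: mult_char_power[OF \<rho>(1)])
    also have "\<dots> = 1"
      using \<rho>(2) a \<open>v \<noteq> 1\<close> by simp
    finally have 1: "\<rho> u * \<rho> v ^ 2 * \<rho> (y * m) = 1"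
      by (simp add: mult_char_mult[OF \<rho>(1)] mult_char_power[OF \<rho>(1)])
    have 2: "\<rho> (y * m) ^ 3 = 1"
      using \<rho>(2) nz by simp
    have "\<rho> u * \<rho> v ^ 2 = (\<rho> u * \<rho> v ^ 2 * \<rho> (y * m)) * \<rho> (y * m) ^ 2"
      using 2 by (simp add: power2_eq_square power3_eq_cube mult.assoc)
    then show "\<rho> u * \<rho> v ^ 2 = (case f (u, v) of (y, m) \<Rightarrow> (\<rho> (y * m))^2)"
      by (simp add: f 1)
  qed
  have gB: "g (y, m) \<in> A" and fg: "f (g (y, m)) = (y, m)" if ym: "(y, m) \<in> B" for y m
  proof -
    have y: "y \<noteq> 0" and m: "m \<noteq> 0" and eq: "m^2 - (y + l * \<kappa>) * m + \<kappa> * y = 0"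
      using ym by (auto simp: B_def)
    \<comment> \<open>At \<open>m = \<kappa>\<close> the variable \<open>y\<close> drops out of the
      relation, leaving \<open>\<kappa>^2 * (1 - l) = 0\<close>; here \<open>l \<noteq> 1\<close>
      enters.\<close>
    have m\<kappa>: "m - \<kappa> \<noteq> 0"
    proof
      assume "m - \<kappa> = 0"
      then have "m = \<kappa>"
        by simp
      then have "\<kappa>^2 * (1 - l) = 0"
        using eq by (simp add: algebra_simps power2_eq_square)
      then show False
        using \<kappa>0 l by simp
    qed
    define u v where "u = m^2 / ((m - \<kappa>) * y)" and "v = \<kappa> / (\<kappa> - m)"
    have g: "g (y, m) = (u, v)"
      by (simp add: g_def u_def v_def)
    have nz: "u \<noteq> 0" "v \<noteq> 0"
      using y m m\<kappa> \<kappa>0 by (auto simp: u_def v_def)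
    have u': "u * (m - \<kappa>) * y = m^2" and v': "v * (m - \<kappa>) = - \<kappa>"
      using y m\<kappa> by (simp_all add: u_def v_def field_simps)
    have m': "y * (m - \<kappa>) = m * (m - l * \<kappa>)"
      using eq by (simp add: algebra_simps power2_eq_square)
    have "(m - \<kappa>)^2 * y * (l * u * v) = l * (u * (m - \<kappa>) * y) * (v * (m - \<kappa>))"
      by Groebner_Basis.algebra
    also have "\<dots> = - l * \<kappa> * m^2"
      unfolding u' v' by Groebner_Basis.algebra
    also have "\<dots> = (m * (m - l * \<kappa>) - m^2) * m"
      by Groebner_Basis.algebra
    also have "\<dots> = (y * (m - \<kappa>) - u * (m - \<kappa>) * y) * (m - \<kappa> - v * (m - \<kappa>))"
      unfolding m' u' v' by Groebner_Basis.algebra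
    also have "\<dots> = (m - \<kappa>)^2 * y * ((1 - u) * (1 - v))"
      by Groebner_Basis.algebra
    finally have "l * u * v = (1 - u) * (1 - v)"
      using y m\<kappa> by simp
    then show "g (y, m) \<in> A"
      using nz by (simp add: g A_def)
    have v1: "(v - 1) * (m - \<kappa>) = - m"
      using v' by (simp add: algebra_simps)
    have "(m - \<kappa>) * (\<kappa> * (v - 1)) = \<kappa> * ((v - 1) * (m - \<kappa>))"
      by (simp only: mult_ac)
    also have "\<dots> = m * (v * (m - \<kappa>))"
      unfolding v1 v' by simp
    also have "\<dots> = (m - \<kappa>) * (m * v)"
      by (simp only: mult_ac)
    finally have "\<kappa> * (v - 1) / v = m"
      using m\<kappa> nz by (simp add: divide_eq_eq)
    moreover have "(m - \<kappa>)^2 * (- \<kappa> * (v - 1)^2) = - \<kappa> * ((v - 1) * (m - \<kappa>))^2"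
      by Groebner_Basis.algebra
    then have "(m - \<kappa>)^2 * (- \<kappa> * (v - 1)^2) = (v * (m - \<kappa>)) * (u * (m - \<kappa>) * y)"
      unfolding v1 u' v' by simp
    then have "(m - \<kappa>)^2 * (- \<kappa> * (v - 1)^2) = (m - \<kappa>)^2 * (y * (u * v))"
      by (simp add: power2_eq_square mult_ac)
    then have "- \<kappa> * (v - 1)^2 = y * (u * v)"
      using m\<kappa> mult_left_cancel[of "(m - \<kappa>)^2"] by (metis power_not_zero)
    then have "- \<kappa> * (v - 1)^2 / (u * v) = y"
      using nz by (metis mult_eq_0_iff nonzero_mult_div_cancel_right)
    ultimately show "f (g (y, m)) = (y, m)"
      by (simp add: g f_def)
  qed
  show ?thesis
    unfolding A_def[symmetric] B_def[symmetric]
    by (rule sum.reindex_bij_witness[of _ f g]) (use fA gf val gB fg in \<open>force split: prod.splits\<close>)+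
qed

text \<open>\<open>LEAST\<close> is informative only once some exponent is known to work;
  \<open>q - 1\<close> is one.\<close>

lemma char_order_eq_3:
  fixes \<rho> :: "'a::{field,finite} \<Rightarrow> complex"
  assumes \<rho>: "\<rho> \<in> mult_chars" and order: "char_order \<rho> = 3"
  shows "\<And>x. x \<noteq> 0 \<Longrightarrow> \<rho> x ^ 3 = 1" "char_pow \<rho> 2 \<noteq> triv_char"
proof -
  have "0 < CARD('a) - 1 \<and> char_pow \<rho> (CARD('a) - 1) = triv_char"
    using card_field_gt_1[where 'a='a] mult_char_power_card_minus_1[OF \<rho>]
    by (auto simp: char_pow_mult_char[OF \<rho>] triv_char_def fun_eq_iff)
  then have "0 < char_order \<rho> \<and> char_pow \<rho> (char_order \<rho>) = triv_char"
    unfolding char_order_def by (rule LeastI)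
  then have "char_pow \<rho> 3 = triv_char"
    using order by simp
  then show "\<rho> x ^ 3 = 1" if "x \<noteq> 0" for x
    using that by (metis char_pow_mult_char[OF \<rho>] mult_1 triv_char_def)
  show "char_pow \<rho> 2 \<noteq> triv_char"
    using not_less_Least[of 2 "\<lambda>n. 0 < n \<and> char_pow \<rho> n = triv_char"] order
    by (simp add: char_order_def)
qed

theorem theorem1p1:
  fixes a1 a3 :: int and p e q :: nat
    and \<rho> :: "'a::{field,finite} \<Rightarrow> complex"
  assumes "elliptic (E_curve a1 a3 :: rat weierstrass)"
    and "prime p" and "odd p"
    and "good_reduction p (E_curve a1 a3)"
    and "\<not> int p dvd a1"
    and "q = p ^ e" and "[q = 1] (mod 3)"
    and "CARD('a) = q"
    and "\<rho> \<in> mult_chars" and "char_order \<rho> = 3"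
  shows "complex_of_int (frob_trace (E_curve a1 a3 :: 'a weierstrass)) =
    - of_nat q * gauss_2F1 \<rho> (char_pow \<rho> 2) triv_char (27 * inverse (of_int a1 ^ 3) * of_int a3)"
proof -
  have q: "q > 1"
    using card_field_gt_1[where 'a='a] assms(8) by simp
  have char: "CHAR('a) = p"
  proof -
    have "prime CHAR('a)"
      by (intro prime_CHAR_semidom finite_imp_CHAR_pos) simp
    moreover have "CHAR('a) dvd p ^ e"
      using CHAR_dvd_CARD[where 'a='a] assms(6,8) by simp
    ultimately show ?thesis
      using \<open>prime p\<close> by (metis prime_dvd_power primes_dvd_imp_eq)
  qed
  have "p \<noteq> 3"
  proof
    assume "p = 3"
    then have "3 dvd q"
      using q \<open>q = p ^ e\<close> by (cases e) auto
    then show False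
      using \<open>[q = 1] (mod 3)\<close> by (simp add: cong_def dvd_eq_mod_eq_0)
  qed
  have of_int_eq_0: "(of_int k :: 'a) = 0 \<longleftrightarrow> int p dvd k" for k
    by (simp add: of_int_eq_0_iff_char_dvd char)
  have two: "(2::'a) \<noteq> 0" and three: "(3::'a) \<noteq> 0"
  proof -
    have "\<not> p dvd 2" "\<not> p dvd 3"
      using prime_ge_2_nat[OF \<open>prime p\<close>] \<open>odd p\<close> \<open>p \<noteq> 3\<close> dvd_imp_le[of p 2] dvd_imp_le[of p 3]
      by (cases "p = 2"; force)+
    then have "(of_nat 2 :: 'a) \<noteq> 0" "(of_nat 3 :: 'a) \<noteq> 0"
      by (simp_all only: of_nat_eq_0_iff_char_dvd char not_False_eq_True)
    then show "(2::'a) \<noteq> 0" "(3::'a) \<noteq> 0"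
      by simp_all
  qed
  define b1 b3 where "b1 = (of_int a1 :: 'a)" and "b3 = (of_int a3 :: 'a)"
  define l where "l = 27 * inverse (b1^3) * b3"
  have b1: "b1 \<noteq> 0"
    using assms(5) by (simp add: b1_def of_int_eq_0)
  have b3: "b3 \<noteq> 0"
    using good_reduction_E_curve(1)[OF assms(2,4,5)] by (simp add: b3_def of_int_eq_0)
  have "b1^3 - 27 * b3 \<noteq> 0"
    using good_reduction_E_curve(2)[OF assms(2,4,5)] of_int_eq_0[of "a1^3 - 27 * a3"]
    by (simp add: b1_def b3_def)
  have "(27::'a) = 3^3"
    by simp
  then have "(27::'a) \<noteq> 0"
    using three by (metis power_not_zero)
  \<comment> \<open>\<open>l \<noteq> 1\<close> is the condition
    \<open>b1^3 \<noteq> 27 * b3\<close>. The form of \<open>b3\<close> matches the resolvent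
    relation with \<open>\<kappa> = (b1 / 3)^3\<close>, visibly a cube.\<close>
  then have l: "l \<noteq> 0" "l \<noteq> 1" and b3_eq: "b3 = l * (b1 / 3)^3"
    using b1 b3 \<open>b1^3 - 27 * b3 \<noteq> 0\<close> by (auto simp: l_def field_simps)
  note cube = char_order_eq_3(1)[OF assms(9,10)]
  \<comment> \<open>The root count uses \<open>\<sigma>\<close> rather than \<open>\<rho>\<close>,
    so that its summands are the squares \<open>(\<rho> (y * m))^2\<close> of the
    reparametrization.\<close>
  define \<sigma> where "\<sigma> = char_pow \<rho> 2"
  have \<sigma>: "\<sigma> \<in> mult_chars" "\<sigma> \<noteq> triv_char"
    using char_pow_in_mult_chars[OF assms(9)] char_order_eq_3(2)[OF assms(9,10)]
    by (simp_all add: \<sigma>_def)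
  have \<sigma>_eq: "\<sigma> x = \<rho> x ^ 2" for x
    using mult_char_0[OF assms(9)] by (simp add: \<sigma>_def char_pow_mult_char[OF assms(9)] triv_char_def)
  have \<sigma>_cube: "\<sigma> x ^ 3 = 1" if "x \<noteq> 0" for x
    using cube[OF that] by (metis \<sigma>_eq power_mult mult.commute power_one)
  have "E_curve a1 a3 = Weierstrass b1 0 b3 0 0"
    by (simp add: E_curve_def b1_def b3_def)
  then have "complex_of_int (frob_trace (E_curve a1 a3 :: 'a weierstrass)) =
      of_nat CARD('a) - of_nat (card (affine_points (Weierstrass b1 0 b3 0 0)))"
    by (simp add: frob_trace_affine_points)
  also have "\<dots> = - (\<Sum>(y, m) | y \<noteq> 0 \<and> m \<noteq> 0 \<and>
      m^2 - (y + b3) * m + (b1 / 3)^3 * y = 0. \<sigma> (y * m))"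
    using card_affine_points_cubic_char[OF \<sigma> \<sigma>_cube two three b1, of b3] by simp
  also have "\<dots> = - (\<Sum>(u, v) | u \<noteq> 0 \<and> v \<noteq> 0 \<and> l * u * v = (1 - u) * (1 - v). \<rho> u * \<sigma> v)"
    using sum_resolvent_reparametrize[OF assms(9) cube _ l refl, of "b1 / 3"] b1 three
    by (simp only: \<sigma>_eq b3_eq) simp
  also have "\<dots> = - (of_nat CARD('a) * gauss_2F1 \<rho> \<sigma> triv_char l)"
    using gauss_2F1_triv[OF assms(9) \<sigma>(1) l(1)] by simp
  finally show ?thesis
    by (simp add: assms(8) \<sigma>_def l_def b1_def b3_def)
qed

end
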